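(* For every integer $k\in\mathbb{Z}$ and every integer $n\geq 0$, $$B_{n+1}^{(k)}(x)=xB_{n}^{(k)}(x)-\frac{1}{n+1}\sum_{l=0}^{n+1}\binom{n+1}{l}B_{l}\left\{B_{n+1-l}^{(k)}(x)-B_{n+1-l}^{(k-1)}(x)\right\},$$ where $B_l$ denotes the $l$-th ordinary Bernoulli number.
   Context: For $k\in\mathbb{Z}$, the polylogarithm is $Li_k(x)=\sum_{m=1}^{\infty}\frac{x^m}{m^k}$. The poly-Bernoulli polynomials $B_n^{(k)}(x)$ are defined by the generating function (an identity of formal power series in $t$) $$\frac{Li_{k}(1-e^{-t})}{1-e^{-t}}e^{xt}=\sum_{n=0}^{\infty}B_{n}^{(k)}(x)\frac{t^{n}}{n!}.$$ The ordinary Bernoulli numbers $B_n$ are defined by $\frac{t}{e^t-1}=\sum_{n=0}^\infty B_n\frac{t^n}{n!}$ (so $B_0=1$, $B_1=-\tfrac12$). *)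

theory Defs
  imports "HOL-Computational_Algebra.Computational_Algebra"
begin

definition polylog_fps :: "int \<Rightarrow> 'a::field_char_0 fps" where
  "polylog_fps k = Abs_fps (\<lambda>m. if m = 0 then 0 else 1 / (of_nat m powi k))"

definition bernoulli_num :: "nat \<Rightarrow> 'a::field_char_0" where
  "bernoulli_num n = fact n * fps_nth (fps_X / (fps_exp 1 - 1)) n"

definition poly_bernoulli_kernel :: "int \<Rightarrow> 'a::field_char_0 fps" where
  "poly_bernoulli_kernel k =
     (polylog_fps k oo (1 - fps_exp (-1))) / (1 - fps_exp (-1))"

text \<open>
  The indeterminate \<open>x\<close> is the polynomial variable and \<open>t\<close> is the power series variable, so
  the generating function is a power series with polynomial coefficients. As division of power
  series is available over a field only, the quotient is formed over the field and its
  coefficients are then embedded as constant polynomials.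
\<close>

definition fps_lift_poly :: "'a::field_char_0 fps \<Rightarrow> 'a poly fps" where
  "fps_lift_poly F = Abs_fps (\<lambda>n. [:fps_nth F n:])"

definition fps_exp_xt :: "'a::field_char_0 poly fps" where
  "fps_exp_xt = Abs_fps (\<lambda>n. monom (1 / fact n) n)"

definition poly_bernoulli_gf :: "int \<Rightarrow> 'a::field_char_0 poly fps" where
  "poly_bernoulli_gf k = fps_lift_poly (poly_bernoulli_kernel k) * fps_exp_xt"

definition poly_bernoulli :: "int \<Rightarrow> nat \<Rightarrow> 'a::field_char_0 poly" where
  "poly_bernoulli k n = smult (fact n) (fps_nth (poly_bernoulli_gf k) n)"

text \<open>
  Both quotients above are exact, so the truncating division of \<^typ>\<open>'a fps\<close> plays no role.
\<close>

lemma subdegree_one_minus_fps_exp: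
  "subdegree (1 - fps_exp (-1) :: 'a::field_char_0 fps) = 1"
  by (rule subdegreeI) auto

lemma poly_bernoulli_kernel_mult:
  "poly_bernoulli_kernel k * (1 - fps_exp (-1)) =
     (polylog_fps k oo (1 - fps_exp (-1)) :: 'a::field_char_0 fps)"
proof -
  let ?y = "1 - fps_exp (-1) :: 'a fps"
  let ?L = "polylog_fps k oo ?y"
  have nz: "?y \<noteq> 0"
    using subdegree_one_minus_fps_exp[where 'a = 'a] by fastforce
  have "fps_nth ?L 0 = 0"
    by (simp add: fps_compose_nth polylog_fps_def)
  then have "?y dvd ?L"
    by (cases "?L = 0")
       (auto simp: fps_dvd_iff[OF nz] subdegree_one_minus_fps_exp Suc_le_eq intro!: gr0I
             dest: nth_subdegree_nonzero)
  then show ?thesis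
    unfolding poly_bernoulli_kernel_def by simp
qed

lemma bernoulli_num_gf:
  "Abs_fps (\<lambda>n. bernoulli_num n / fact n) * (fps_exp 1 - 1) = (fps_X :: 'a::field_char_0 fps)"
proof -
  let ?e = "fps_exp 1 - 1 :: 'a fps"
  have s: "subdegree ?e = 1"
    by (rule subdegreeI) auto
  then have nz: "?e \<noteq> 0"
    by fastforce
  have "?e dvd fps_X"
    unfolding fps_dvd_iff[OF nz fps_X_neq_zero] s by simp
  moreover have "Abs_fps (\<lambda>n. bernoulli_num n / fact n) = fps_X / ?e"
    by (simp add: fps_eq_iff bernoulli_num_def)
  ultimately show ?thesis
    by simp
qed

lemma poly_poly_bernoulli:
  "poly (poly_bernoulli k n) x / fact n =
     fps_nth (poly_bernoulli_kernel k * fps_exp (x :: 'a::field_char_0)) n"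
  by (simp add: poly_bernoulli_def poly_bernoulli_gf_def fps_lift_poly_def fps_exp_xt_def
      fps_mult_nth poly_sum poly_monom)

end

theory Submission
  imports Defs
begin

text \<open>
  Write \<open>y = 1 - e\<^sup>-\<^sup>t\<close> and let \<open>K\<^sub>k = Li\<^sub>k(y) / y\<close> be the generating function at \<open>x = 0\<close>. Since
  \<open>u Li\<^sub>k'(u) = Li\<^sub>k\<^sub>-\<^sub>1(u)\<close>, differentiating \<open>K\<^sub>k y = Li\<^sub>k(y)\<close> in \<open>t\<close> and cancelling \<open>y\<close>
  gives \<open>K\<^sub>k' (e\<^sup>t - 1) = K\<^sub>k\<^sub>-\<^sub>1 - K\<^sub>k\<close>. Multiplication by the Bernoulli series
  \<open>t / (e\<^sup>t - 1)\<close> turns this into a formula for \<open>t K\<^sub>k'\<close>, hence for the \<open>t\<close>-derivative of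
  \<open>K\<^sub>k e\<^sup>x\<^sup>t\<close>, and the claim is obtained by comparing coefficients.
\<close>

lemma fps_X_mult_deriv_polylog_fps:
  "fps_X * fps_deriv (polylog_fps k) = (polylog_fps (k - 1) :: 'a::field_char_0 fps)"
proof (rule fps_ext)
  fix m
  show "fps_nth (fps_X * fps_deriv (polylog_fps k)) m = fps_nth (polylog_fps (k - 1) :: 'a fps) m"
  proof (cases m)
    case (Suc j)
    then have "(of_nat m :: 'a) \<noteq> 0"
      using of_nat_neq_0 by blast
    with Suc show ?thesis
      by (simp add: polylog_fps_def power_int_diff del: of_nat_Suc)
  qed (simp add: polylog_fps_def)
qed

lemma fps_deriv_poly_bernoulli_kernel:
  "fps_deriv (poly_bernoulli_kernel k) * (fps_exp 1 - 1) =
     poly_bernoulli_kernel (k - 1) - (poly_bernoulli_kernel k :: 'a::field_char_0 fps)"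
proof -
  define e :: "'a fps" where "e = fps_exp (-1)"
  define y :: "'a fps" where "y = 1 - e"
  define K :: "int \<Rightarrow> 'a fps" where "K = poly_bernoulli_kernel"
  have y0: "fps_nth y 0 = 0"
    by (simp add: y_def e_def)
  have y_nz: "y \<noteq> 0"
    using subdegree_one_minus_fps_exp[where 'a = 'a] by (fastforce simp: y_def e_def)
  have y': "fps_deriv y = e"
    by (simp add: y_def e_def flip: fps_const_neg)
  have Ky: "K j * y = polylog_fps j oo y" for j
    using poly_bernoulli_kernel_mult[of j] by (simp add: K_def y_def e_def)
  \<comment> \<open>The extra factor \<open>y\<close> is \<open>fps_X oo y\<close>: it turns the
    composed derivative of \<open>polylog_fps k\<close> into
    \<open>polylog_fps (k - 1) oo y\<close>, and is cancelled afterwards.\<close>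
  have "y * (fps_deriv (K k) * y + K k * e) = y * fps_deriv (K k * y)"
    by (simp add: y' algebra_simps)
  also have "\<dots> = y * ((fps_deriv (polylog_fps k) oo y) * e)"
    by (simp add: Ky fps_compose_deriv y0 y')
  also have "\<dots> = ((fps_X * fps_deriv (polylog_fps k)) oo y) * e"
    by (simp add: fps_compose_mult_distrib y0 mult.assoc)
  also have "\<dots> = y * (K (k - 1) * e)"
    by (simp add: fps_X_mult_deriv_polylog_fps flip: Ky)
  finally have "fps_deriv (K k) * y + K k * e = K (k - 1) * e"
    using y_nz by simp
  then have *: "fps_deriv (K k) * y = (K (k - 1) - K k) * e"
    by (simp add: algebra_simps)
  have inv: "e * fps_exp 1 = 1"
    by (simp add: e_def flip: fps_exp_add_mult)
  \<comment> \<open>Here \<open>fps_exp 1 - 1 = y * fps_exp 1\<close>, because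
    \<open>y = 1 - e\<close>.\<close>
  have "fps_deriv (K k) * (fps_exp 1 - 1) = fps_deriv (K k) * y * fps_exp 1"
    using inv by (simp add: y_def algebra_simps)
  also have "\<dots> = K (k - 1) - K k"
    by (simp add: * mult.assoc inv)
  finally show ?thesis
    by (simp add: K_def)
qed

lemma fps_X_mult_deriv_poly_bernoulli_gf:
  fixes x :: "'a::field_char_0"
  defines "G \<equiv> \<lambda>k. poly_bernoulli_kernel k * fps_exp x"
  shows "fps_X * fps_deriv (G k) =
    fps_const x * (fps_X * G k)
    - Abs_fps (\<lambda>n. bernoulli_num n / fact n) * (G k - G (k - 1))"
proof -
  let ?B = "Abs_fps (\<lambda>n. bernoulli_num n / fact n) :: 'a fps"
  let ?K = poly_bernoulli_kernel
  have "fps_X * fps_deriv (?K k) = ?B * (fps_deriv (?K k) * (fps_exp 1 - 1))"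
    by (simp only: bernoulli_num_gf[symmetric] ac_simps)
  also have "\<dots> = ?B * (?K (k - 1) - ?K k)"
    by (simp only: fps_deriv_poly_bernoulli_kernel)
  finally have "fps_X * fps_deriv (?K k) * fps_exp x = ?B * (?K (k - 1) - ?K k) * fps_exp x"
    by (rule arg_cong)
  \<comment> \<open>By the product rule, differentiating \<open>fps_exp x\<close> contributes the
    term in \<open>x\<close>.\<close>
  then show ?thesis
    by (simp add: G_def algebra_simps)
qed

theorem theorem1:
  fixes k :: int and n :: nat
  shows "(poly_bernoulli k (n + 1) :: 'a::field_char_0 poly) =
    [:0, 1:] * poly_bernoulli k n
    - smult (1 / of_nat (n + 1))
        (\<Sum>l = 0..n + 1. smult (of_nat ((n + 1) choose l) * bernoulli_num l)
           (poly_bernoulli k (n + 1 - l) - poly_bernoulli (k - 1) (n + 1 - l)))"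
    (is "?lhs = ?rhs")
proof -
  \<comment> \<open>The field is infinite, so it suffices to compare values at every
    \<open>x\<close>; this allows working with power series over the field itself.\<close>
  have "poly ?lhs x = poly ?rhs x" for x :: 'a
  proof -
    define b where "b j m = poly (poly_bernoulli j m) x" for j m
    define c where "c l = (bernoulli_num l :: 'a)" for l
    define N :: 'a where "N = of_nat (n + 1)"
    define S where "S = (\<Sum>l = 0..n + 1. of_nat ((n + 1) choose l) * c l *
      (b k (n + 1 - l) - b (k - 1) (n + 1 - l)))"
    have N: "N \<noteq> 0"
      unfolding N_def by (simp del: of_nat_Suc)
    have G: "fps_nth (poly_bernoulli_kernel j * fps_exp x) m = b j m / fact m" for j m
      by (simp add: b_def poly_poly_bernoulli)
    \<comment> \<open>Coefficient \<open>n + 1\<close> is the right one: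
      \<open>fps_X * fps_deriv F\<close> contributes \<open>n + 1\<close> times coefficient
      \<open>n + 1\<close> of \<open>F\<close>, while \<open>fps_X * F\<close> contributes
      coefficient \<open>n\<close>.\<close>
    have "N * (b k (n + 1) / fact (n + 1)) = x * (b k n / fact n)
        - (\<Sum>l = 0..n + 1. c l / fact l *
            (b k (n + 1 - l) / fact (n + 1 - l) - b (k - 1) (n + 1 - l) / fact (n + 1 - l)))"
      using arg_cong[OF fps_X_mult_deriv_poly_bernoulli_gf[of k x], of "\<lambda>F. fps_nth F (n + 1)"]
      unfolding fps_sub_nth fps_mult_left_const_nth fps_mult_nth[of "Abs_fps _"] N_def
      by (simp add: G c_def del: of_nat_Suc sum.atLeast0_atMost_Suc fact_Suc fps_deriv_mult)
    also have "(\<Sum>l = 0..n + 1. c l / fact l *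
            (b k (n + 1 - l) / fact (n + 1 - l) - b (k - 1) (n + 1 - l) / fact (n + 1 - l)))
        = S / fact (n + 1)"
      unfolding S_def sum_divide_distrib
      by (rule sum.cong) (auto simp: binomial_fact field_simps simp del: fact_Suc)
    finally have "N * (b k (n + 1) / (N * fact n)) = x * (b k n / fact n) - S / (N * fact n)"
      by (simp add: S_def N_def del: of_nat_Suc)
    then have "b k (n + 1) = x * b k n - 1 / N * S"
      using N by (simp add: field_simps)
    then show ?thesis
      by (simp add: S_def b_def c_def N_def poly_sum del: of_nat_Suc sum.atLeast0_atMost_Suc)
  qed
  then show ?thesis
    by (simp add: poly_eq_poly_eq_iff[symmetric] fun_eq_iff)
qed

end
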